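(* Let $k,l,t,n$ be positive integers, let $A_k$ be the $k$-element antichain, and let $L=\min\{l-1,k-1\}$. Then \[ \operatorname{RT}^{\sharp}(\mathcal{B};n,A_k,l,t)\le \begin{cases} 0, & \text{if } L=0,\\ \displaystyle\sum_{i=1}^{\min(t,L)}\binom{L}{i}\binom{i(n+1)}{t}, & \text{if } L\ge 1, \end{cases} \] and, whenever $n\ge L$, \[ \operatorname{RT}^{\sharp}(\mathcal{B};n,A_k,l,t)\ge \begin{cases} 0, & \text{if } L=0 \text{ or } t>n-L+1,\\ \displaystyle L\binom{n-L+1}{t}, & \text{if } L\ge 1 \text{ and } t\le n-L+1. \end{cases} \] In particular, for fixed $k,l,t$ and $n\to\infty$, if $L\ge 1$, then $\operatorname{RT}^{\sharp}(\mathcal{B};n,A_k,l,t)=\Theta(n^t)$, and when $t=1$ we have $\operatorname{RT}^{\sharp}(\mathcal{B};n,A_k,l,1)=Ln+O(1)$.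
   Context: $B_n$ is the power set of $[n]=\{1,\dots,n\}$ ordered by inclusion; a subset $Q\subseteq B_n$ (possibly empty) is regarded as a poset with the induced order. A $t$-chain in a poset is a set of exactly $t$ distinct pairwise comparable elements, and $\mathcal{C}_t(Q)$ is the set of all $t$-chains of $Q$. The width $w(Q)$ is the size of a largest antichain of $Q$ (with $w(\emptyset)=0$). $A_k$ is the poset with $k$ pairwise incomparable elements. An injection $f:P\to Q$ between posets is a strong embedding if $x\le y$ in $P$ if and only if $f(x)\le f(y)$ in $Q$. $Q$ is strongly $P$-free if there is no strong embedding of $P$ into $Q$. $\operatorname{RT}^{\sharp}(\mathcal{B};n,P,l,t)$ is the maximum of $|\mathcal{C}_t(Q)|$ over all $Q\subseteq B_n$ such that $Q$ is strongly $P$-free and $w(Q)<l$. $a_n=\Theta(b_n)$ means that there are constants $c,C>0$ with $c\,b_n\le a_n\le C\,b_n$ for all sufficiently large $n$. *)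

theory Defs
  imports "HOL-Library.Landau_Symbols"
begin

text \<open>
  A poset is represented by its reflexive order relation, whose \<^const>\<open>Field\<close> is then the ground
  set. A subset \<open>Q\<close> of the Boolean lattice carries the induced order
  \<open>relation_of (\<subseteq>) Q\<close>.
\<close>

definition antichain_poset :: "nat \<Rightarrow> nat rel" where
  "antichain_poset k = Id_on {..<k}"

definition t_chains :: "'a rel \<Rightarrow> nat \<Rightarrow> 'a set set" where
  "t_chains r t = {C \<in> Chains r. finite C \<and> card C = t}"

definition antichains :: "'a rel \<Rightarrow> 'a set set" where
  "antichains r = {A. A \<subseteq> Field r \<and> (\<forall>x\<in>A. \<forall>y\<in>A. x \<noteq> y \<longrightarrow> (x, y) \<notin> r)}"

text \<open>Meaningful for finite posets only.\<close>

definition width :: "'a rel \<Rightarrow> nat" where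
  "width r = Max (card ` antichains r)"

definition strong_embedding :: "'a rel \<Rightarrow> 'b rel \<Rightarrow> ('a \<Rightarrow> 'b) \<Rightarrow> bool" where
  "strong_embedding r s f \<longleftrightarrow>
     f ` Field r \<subseteq> Field s \<and> inj_on f (Field r) \<and>
     (\<forall>x\<in>Field r. \<forall>y\<in>Field r. (x, y) \<in> r \<longleftrightarrow> (f x, f y) \<in> s)"

definition strongly_free :: "'a rel \<Rightarrow> 'b rel \<Rightarrow> bool" where
  "strongly_free p q \<longleftrightarrow> (\<nexists>f. strong_embedding p q f)"

definition boolean_lattice :: "nat \<Rightarrow> nat set set" where
  "boolean_lattice n = Pow {1..n}"

text \<open>
  If \<open>p\<close> is nonempty and \<open>l \<ge> 1\<close>, the empty family is admissible, so the maximum below is over a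
  finite nonempty set.
\<close>

definition RT_sharp :: "nat \<Rightarrow> 'a rel \<Rightarrow> nat \<Rightarrow> nat \<Rightarrow> nat" where
  "RT_sharp n p l t =
     Max {card (t_chains (relation_of (\<subseteq>) Q) t) | Q.
            Q \<subseteq> boolean_lattice n \<and>
            strongly_free p (relation_of (\<subseteq>) Q) \<and>
            width (relation_of (\<subseteq>) Q) < l}"

end

theory Submission
  imports Defs "HOL-Library.Disjoint_Sets"
begin

text \<open>
  A finite poset contains \<open>A\<^sub>k\<close> as an induced subposet exactly when its width is at least \<open>k\<close>, so
  the two conditions on \<open>Q\<close> together say that the width of \<open>Q\<close> is at most \<open>L\<close>.

  For the upper bound, slice \<open>Q\<close> by cardinality: each of the \<open>n + 1\<close> levels is an antichain, hence
  \<open>Q\<close> has at most \<open>L * (n + 1)\<close> members and at most \<open>(L * (n + 1)) choose t\<close> many \<open>t\<close>-chains.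
  The sum in the statement is at least this binomial coefficient: think of an \<open>L \<times> (n + 1)\<close>
  grid and sort its \<open>t\<close>-subsets by the set of rows that they meet.

  For the lower bound, take the \<open>L\<close> pairwise disjoint chains
  \<open>{i} \<subset> {i, L + 1} \<subset> \<dots> \<subset> {i, L + 1, \<dots>, n}\<close> with \<open>1 \<le> i \<le> L\<close>. Their union has
  width at most \<open>L\<close>, since an antichain meets every chain at most once, and every \<open>t\<close>-subset of one
  of them is a \<open>t\<close>-chain.

  Both bounds are of order \<open>n ^ t\<close>, and for \<open>t = 1\<close> they are \<open>L * (n + 1)\<close> and
  \<open>L * (n - L + 1)\<close>, which differ by a constant.
\<close>

section \<open>Width and induced antichains\<close>

lemma width_le_iff:
  assumes "finite (Field r)"
  shows "width r \<le> m \<longleftrightarrow> (\<forall>A\<in>antichains r. card A \<le> m)"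
proof -
  have "antichains r \<subseteq> Pow (Field r)" by (auto simp: antichains_def)
  then have "finite (antichains r)" using assms finite_subset by blast
  moreover have "{} \<in> antichains r" by (simp add: antichains_def)
  ultimately show ?thesis by (subst width_def, subst Max_le_iff) auto
qed

lemma Field_antichain_poset: "Field (antichain_poset k) = {..<k}"
  by (auto simp: antichain_poset_def Field_def Id_on_iff)

lemma antichain_poset_iff: "(x, y) \<in> antichain_poset k \<longleftrightarrow> x = y \<and> x < k"
  by (auto simp: antichain_poset_def Id_on_iff)

text \<open>
  Reflexivity of \<open>r\<close> matters because \<^const>\<open>strong_embedding\<close> also compares each point with itself.
\<close>

lemma strongly_free_antichain_poset_iff:
  assumes "finite (Field r)" "refl_on (Field r) r"
  shows "strongly_free (antichain_poset k) r \<longleftrightarrow> width r < k"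
proof -
  have "(\<exists>f. strong_embedding (antichain_poset k) r f) \<longleftrightarrow> (\<exists>A\<in>antichains r. k \<le> card A)"
  proof
    assume "\<exists>f. strong_embedding (antichain_poset k) r f"
    then obtain f where f: "strong_embedding (antichain_poset k) r f" ..
    have "(f x, f y) \<notin> r" if "x < k" "y < k" "f x \<noteq> f y" for x y
    proof -
      have "x \<noteq> y" using that by blast
      then show ?thesis
        using f that by (simp add: strong_embedding_def Field_antichain_poset antichain_poset_iff)
    qed
    then have "f ` {..<k} \<in> antichains r"
      using f by (auto simp: antichains_def strong_embedding_def Field_antichain_poset)
    moreover have "card (f ` {..<k}) = k"
      using f by (simp add: strong_embedding_def Field_antichain_poset card_image)
    ultimately show "\<exists>A\<in>antichains r. k \<le> card A" by force
  next
    assume "\<exists>A\<in>antichains r. k \<le> card A"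
    then obtain A where A: "A \<in> antichains r" "k \<le> card A" by blast
    obtain B where B: "B \<subseteq> A" "card B = k" "finite B"
      using obtain_subset_with_card_n[OF A(2)] by blast
    obtain f where f: "bij_betw f {..<k} B"
      using B ex_bij_betw_nat_finite[of B] by (auto simp: atLeast0LessThan)
    have mem: "f x \<in> A" if "x < k" for x
      using f B that by (auto simp: bij_betw_def)
    have "(x = y) \<longleftrightarrow> (f x, f y) \<in> r" if "x < k" "y < k" for x y
    proof (cases "x = y")
      case True
      then show ?thesis
        using mem[OF that(1)] A(1) assms(2) by (auto simp: antichains_def refl_on_def)
    next
      case False
      then have "f x \<noteq> f y"
        using f that by (auto simp: bij_betw_def inj_on_def)
      then show ?thesis
        using False mem that A(1) by (auto simp: antichains_def)
    qed
    then have "strong_embedding (antichain_poset k) r f"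
      using f mem A(1)
      by (auto simp: strong_embedding_def Field_antichain_poset antichain_poset_iff bij_betw_def
          antichains_def)
    then show "\<exists>f. strong_embedding (antichain_poset k) r f" by blast
  qed
  moreover have "width r < k \<longleftrightarrow> \<not> (\<exists>A\<in>antichains r. k \<le> card A)"
  proof (cases k)
    case 0
    have "{} \<in> antichains r" by (simp add: antichains_def)
    then show ?thesis using 0 by auto
  next
    case (Suc m)
    then show ?thesis
      using width_le_iff[OF assms(1), of m] by (auto simp: less_Suc_eq_le not_le)
  qed
  ultimately show ?thesis by (simp add: strongly_free_def)
qed

lemma Field_relation_of_subset: "Field (relation_of (\<subseteq>) Q) = Q"
  by (auto simp: relation_of_def Field_def)

lemma refl_on_relation_of_subset: "refl_on Q (relation_of (\<subseteq>) Q)"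
  by (auto simp: relation_of_def refl_on_def)

lemma finite_boolean_lattice: "finite (boolean_lattice n)"
  by (simp add: boolean_lattice_def)

lemma RT_sharp_antichain_poset:
  assumes "k \<ge> 1" "l \<ge> 1"
  shows "RT_sharp n (antichain_poset k) l t =
    Max ((\<lambda>Q. card (t_chains (relation_of (\<subseteq>) Q) t)) `
      {Q. Q \<subseteq> boolean_lattice n \<and> width (relation_of (\<subseteq>) Q) \<le> min (l - 1) (k - 1)})"
proof -
  have "strongly_free (antichain_poset k) (relation_of (\<subseteq>) Q) \<and> width (relation_of (\<subseteq>) Q) < l
      \<longleftrightarrow> width (relation_of (\<subseteq>) Q) \<le> min (l - 1) (k - 1)" if "Q \<subseteq> boolean_lattice n" for Q
  proof -
    have "finite Q" using that finite_boolean_lattice finite_subset by blast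
    then have "strongly_free (antichain_poset k) (relation_of (\<subseteq>) Q)
        \<longleftrightarrow> width (relation_of (\<subseteq>) Q) < k"
      by (intro strongly_free_antichain_poset_iff)
         (simp_all add: Field_relation_of_subset refl_on_relation_of_subset)
    then show ?thesis using assms by auto
  qed
  then have "{Q. Q \<subseteq> boolean_lattice n \<and> strongly_free (antichain_poset k) (relation_of (\<subseteq>) Q) \<and>
        width (relation_of (\<subseteq>) Q) < l} =
      {Q. Q \<subseteq> boolean_lattice n \<and> width (relation_of (\<subseteq>) Q) \<le> min (l - 1) (k - 1)}"
    by blast
  then show ?thesis
    by (simp add: RT_sharp_def setcompr_eq_image)
qed

section \<open>The upper bound\<close>

text \<open>
  Two distinct sets of the same finite size are incomparable, so every level of the Boolean lattice
  contributes at most \<open>w\<close> members.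
\<close>

lemma card_family_le_of_width_le:
  assumes Q: "Q \<subseteq> boolean_lattice n" and w: "width (relation_of (\<subseteq>) Q) \<le> w"
  shows "card Q \<le> w * (n + 1)"
proof -
  have finQ: "finite Q" using Q finite_boolean_lattice finite_subset by blast
  have finX: "finite X \<and> card X \<le> n" if "X \<in> Q" for X
  proof -
    have "X \<subseteq> {1..n}" using that Q by (auto simp: boolean_lattice_def)
    then show ?thesis using card_mono[of "{1..n}" X] finite_subset[of X "{1..n}"] by simp
  qed
  have level: "card {X \<in> Q. card X = j} \<le> w" for j
  proof -
    have "X = Y" if "X \<in> Q" "Y \<in> Q" "card X = card Y" "X \<subseteq> Y" for X Y
      using that finX by (intro card_subset_eq) auto
    then have "{X \<in> Q. card X = j} \<in> antichains (relation_of (\<subseteq>) Q)"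
      unfolding antichains_def Field_relation_of_subset by (simp add: relation_of_def) blast
    then show ?thesis
      using w width_le_iff[of "relation_of (\<subseteq>) Q" w] finQ by (simp add: Field_relation_of_subset)
  qed
  have "Q = (\<Union>j\<le>n. {X \<in> Q. card X = j})" using finX by auto
  then have "card Q \<le> (\<Sum>j\<le>n. card {X \<in> Q. card X = j})"
    using card_UN_le[of "{..n}" "\<lambda>j. {X \<in> Q. card X = j}"] by simp
  also have "\<dots> \<le> (\<Sum>j\<le>n. w)" by (intro sum_mono level)
  finally show ?thesis by (simp add: mult.commute)
qed

lemma Chains_subset_Field: "C \<in> Chains r \<Longrightarrow> C \<subseteq> Field r"
  by (auto simp: Chains_def Field_def)

lemma card_t_chains_le:
  assumes "finite (Field r)"
  shows "card (t_chains r t) \<le> card (Field r) choose t"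
proof -
  have "t_chains r t \<subseteq> {T. T \<subseteq> Field r \<and> card T = t}"
    using Chains_subset_Field by (fastforce simp: t_chains_def)
  then show ?thesis
    using assms card_mono[of "{T. T \<subseteq> Field r \<and> card T = t}" "t_chains r t"]
    by (simp add: n_subsets)
qed

text \<open>
  Every \<open>t\<close>-subset of an \<open>L \<times> m\<close> grid lies in the sub-grid formed by the rows that it meets,
  and it meets between \<open>1\<close> and \<open>min t L\<close> rows.
\<close>

lemma binomial_mult_le_sum:
  assumes "t \<ge> 1"
  shows "(L * m) choose t \<le> (\<Sum>i=1..min t L. (L choose i) * ((i * m) choose t))"
proof -
  define sub where "sub = (\<lambda>I :: nat set. {T. T \<subseteq> I \<times> {..<m} \<and> card T = t})"
  define rows where "rows = (\<lambda>i. {I. I \<subseteq> {..<L} \<and> card I = i})"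
  have fin_rows: "finite (rows i)" for i by (simp add: rows_def)
  have fin_sub: "finite (sub I)" if "finite I" for I
    using that by (simp add: sub_def)
  have card_sub: "card (sub I) = (i * m) choose t" if "I \<in> rows i" for I i
    using that finite_subset[of I "{..<L}"]
    by (auto simp: sub_def rows_def n_subsets card_cartesian_product)
  have "sub {..<L} \<subseteq> (\<Union>i\<in>{1..min t L}. \<Union>I\<in>rows i. sub I)"
  proof
    fix T assume "T \<in> sub {..<L}"
    then have T: "T \<subseteq> {..<L} \<times> {..<m}" "card T = t" by (auto simp: sub_def)
    then have "finite T" using finite_subset by blast
    have "fst ` T \<subseteq> {..<L}" using T by auto
    moreover have "card (fst ` T) \<le> t" using T card_image_le[OF \<open>finite T\<close>] by blast
    moreover have "card (fst ` T) \<noteq> 0" using \<open>finite T\<close> T assms by auto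
    moreover have "T \<in> sub (fst ` T)" using T by (force simp: sub_def)
    ultimately show "T \<in> (\<Union>i\<in>{1..min t L}. \<Union>I\<in>rows i. sub I)"
      using card_mono[of "{..<L}" "fst ` T"]
      by (intro UN_I[of "card (fst ` T)"] UN_I[of "fst ` T"]) (auto simp: rows_def Suc_le_eq)
  qed
  moreover have "finite (\<Union>i\<in>{1..min t L}. \<Union>I\<in>rows i. sub I)"
    by (intro finite_UN_I fin_rows fin_sub)
       (auto simp: rows_def intro: finite_subset[OF _ finite_lessThan])
  ultimately have "card (sub {..<L}) \<le> card (\<Union>i\<in>{1..min t L}. \<Union>I\<in>rows i. sub I)"
    by (rule card_mono[rotated])
  also have "\<dots> \<le> (\<Sum>i=1..min t L. card (\<Union>I\<in>rows i. sub I))"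
    by (intro card_UN_le) simp
  also have "\<dots> \<le> (\<Sum>i=1..min t L. \<Sum>I\<in>rows i. card (sub I))"
    by (intro sum_mono card_UN_le fin_rows)
  also have "\<dots> = (\<Sum>i=1..min t L. (L choose i) * ((i * m) choose t))"
    by (intro sum.cong refl) (simp add: card_sub rows_def n_subsets)
  finally show ?thesis
    by (simp add: sub_def n_subsets card_cartesian_product)
qed

lemma RT_sharp_antichain_poset_le:
  assumes "k \<ge> 1" "l \<ge> 1"
  shows "RT_sharp n (antichain_poset k) l t \<le> (min (l - 1) (k - 1) * (n + 1)) choose t"
proof -
  let ?L = "min (l - 1) (k - 1)"
  let ?F = "{Q. Q \<subseteq> boolean_lattice n \<and> width (relation_of (\<subseteq>) Q) \<le> ?L}"
  have "finite ?F" by (simp add: finite_boolean_lattice)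
  moreover have "{} \<in> ?F"
    by (auto simp: width_le_iff Field_relation_of_subset antichains_def)
  moreover have "card (t_chains (relation_of (\<subseteq>) Q) t) \<le> (?L * (n + 1)) choose t"
    if "Q \<in> ?F" for Q
  proof -
    have "finite Q" using that finite_boolean_lattice finite_subset by blast
    then have "card (t_chains (relation_of (\<subseteq>) Q) t) \<le> card Q choose t"
      using card_t_chains_le[of "relation_of (\<subseteq>) Q"] by (simp add: Field_relation_of_subset)
    also have "\<dots> \<le> (?L * (n + 1)) choose t"
      using that by (intro binomial_right_mono card_family_le_of_width_le) auto
    finally show ?thesis .
  qed
  ultimately show ?thesis
    unfolding RT_sharp_antichain_poset[OF assms] by (subst Max_le_iff) blast+
qed

section \<open>The lower bound\<close>

text \<open>
  This is the easy half of Dilworth's theorem: an antichain meets each chain at most once.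
\<close>

lemma width_le_of_chain_cover:
  assumes "finite (Field r)" "finite I" "Field r \<subseteq> (\<Union>i\<in>I. C i)" "\<And>i. i \<in> I \<Longrightarrow> C i \<in> Chains r"
  shows "width r \<le> card I"
  unfolding width_le_iff[OF assms(1)]
proof
  fix A assume A: "A \<in> antichains r"
  then have "\<forall>x\<in>A. \<exists>i\<in>I. x \<in> C i" using assms(3) by (fastforce simp: antichains_def)
  then obtain g where g: "\<And>x. x \<in> A \<Longrightarrow> g x \<in> I \<and> x \<in> C (g x)" by metis
  have "inj_on g A"
  proof
    fix x y assume xy: "x \<in> A" "y \<in> A" "g x = g y"
    then have "(x, y) \<in> r \<or> (y, x) \<in> r"
      using g[of x] g[of y] assms(4)[of "g x"] by (auto simp: Chains_def)
    then show "x = y" using A xy by (auto simp: antichains_def)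
  qed
  then show "card A \<le> card I" using g assms(2) by (intro card_inj_on_le[of g]) auto
qed

text \<open>
  Disjointness together with \<open>t \<ge> 1\<close> keeps a \<open>t\<close>-chain from being counted for two indices.
\<close>

lemma sum_binomial_le_card_t_chains:
  assumes "finite (Field r)" "finite I" "t \<ge> 1" "\<And>i. i \<in> I \<Longrightarrow> C i \<in> Chains r"
    and disj: "disjoint_family_on C I"
  shows "(\<Sum>i\<in>I. card (C i) choose t) \<le> card (t_chains r t)"
proof -
  define sub where "sub = (\<lambda>i. {T. T \<subseteq> C i \<and> card T = t})"
  have finC: "finite (C i)" if "i \<in> I" for i
    using that assms(1,4) Chains_subset_Field finite_subset by metis
  have "(\<Sum>i\<in>I. card (C i) choose t) = (\<Sum>i\<in>I. card (sub i))"
    using finC by (simp add: sub_def n_subsets)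
  also have "\<dots> = card (\<Union>i\<in>I. sub i)"
  proof (rule card_UN_disjoint[symmetric])
    show "\<forall>i\<in>I. finite (sub i)" using finC by (simp add: sub_def)
    show "\<forall>i\<in>I. \<forall>j\<in>I. i \<noteq> j \<longrightarrow> sub i \<inter> sub j = {}"
    proof (intro ballI impI equals0I)
      fix i j T assume ij: "i \<in> I" "j \<in> I" "i \<noteq> j" and "T \<in> sub i \<inter> sub j"
      then have "T \<subseteq> C i \<inter> C j" "card T = t" by (auto simp: sub_def)
      moreover have "C i \<inter> C j = {}" using disj ij by (simp add: disjoint_family_on_def)
      ultimately show False using assms(3) by simp
    qed
  qed (rule assms(2))
  also have "\<dots> \<le> card (t_chains r t)"
  proof (rule card_mono)
    have "t_chains r t \<subseteq> Pow (Field r)"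
      using Chains_subset_Field by (fastforce simp: t_chains_def)
    then show "finite (t_chains r t)" using assms(1) finite_subset by blast
    show "(\<Union>i\<in>I. sub i) \<subseteq> t_chains r t"
    proof
      fix T assume "T \<in> (\<Union>i\<in>I. sub i)"
      then obtain i where i: "i \<in> I" "T \<subseteq> C i" "card T = t" by (auto simp: sub_def)
      moreover have "finite T" using i finC finite_subset by blast
      ultimately show "T \<in> t_chains r t"
        using assms(4)[of i] by (auto simp: t_chains_def Chains_def subset_iff)
    qed
  qed
  finally show ?thesis .
qed

text \<open>
  The chain \<open>{i} \<subset> {i, L + 1} \<subset> \<dots> \<subset> {i, L + 1, \<dots>, n}\<close>; the shared elements
  \<open>L + 1, \<dots>, n\<close> start above every index \<open>i \<le> L\<close>.
\<close>

definition tooth :: "nat \<Rightarrow> nat \<Rightarrow> nat \<Rightarrow> nat set set" where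
  "tooth n L i = (\<lambda>j. insert i {L + 1..L + j}) ` {..n - L}"

lemma card_tooth:
  assumes "i \<le> L"
  shows "card (tooth n L i) = n - L + 1"
proof -
  have "card (insert i {L + 1..L + j}) = j + 1" for j
    using assms by simp
  then have "inj_on (\<lambda>j. insert i {L + 1..L + j}) {..n - L}"
    by (intro inj_onI) (metis add_right_cancel)
  then show ?thesis by (simp add: tooth_def card_image)
qed

lemma tooth_linear: "X \<in> tooth n L i \<Longrightarrow> Y \<in> tooth n L i \<Longrightarrow> X \<subseteq> Y \<or> Y \<subseteq> X"
  by (auto simp: tooth_def)

lemma tooth_subset_boolean_lattice:
  "1 \<le> i \<Longrightarrow> i \<le> L \<Longrightarrow> L \<le> n \<Longrightarrow> tooth n L i \<subseteq> boolean_lattice n"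
  by (auto simp: tooth_def boolean_lattice_def)

text \<open>The index of a chain can be read off from any of its members.\<close>

lemma disjoint_family_on_tooth: "disjoint_family_on (tooth n L) {1..L}"
proof -
  have "X \<inter> {1..L} = {i}" if "X \<in> tooth n L i" "i \<in> {1..L}" for X i
    using that by (auto simp: tooth_def)
  then show ?thesis
    unfolding disjoint_family_on_def by (metis disjoint_iff singleton_inject)
qed

lemma RT_sharp_antichain_poset_ge:
  assumes "k \<ge> 1" "l \<ge> 1" "t \<ge> 1" and L: "L = min (l - 1) (k - 1)" and "L \<le> n"
  shows "L * ((n - L + 1) choose t) \<le> RT_sharp n (antichain_poset k) l t"
proof -
  define Q where "Q = (\<Union>i\<in>{1..L}. tooth n L i)"
  let ?r = "relation_of (\<subseteq>) Q"
  have Q: "Q \<subseteq> boolean_lattice n"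
    unfolding Q_def using \<open>L \<le> n\<close> by (intro UN_least tooth_subset_boolean_lattice) auto
  then have "finite (Field ?r)"
    using finite_boolean_lattice finite_subset by (auto simp: Field_relation_of_subset)
  moreover have chain: "tooth n L i \<in> Chains ?r" if "i \<in> {1..L}" for i
  proof -
    have "tooth n L i \<subseteq> Q" using that by (auto simp: Q_def)
    then show ?thesis
      using tooth_linear[of _ n L i] by (auto simp: Chains_def relation_of_def)
  qed
  ultimately have "width ?r \<le> card {1..L}"
    by (intro width_le_of_chain_cover[where C = "tooth n L"])
       (auto simp: Field_relation_of_subset Q_def)
  have "L * ((n - L + 1) choose t) = (\<Sum>i\<in>{1..L}. card (tooth n L i) choose t)"
    by (simp add: card_tooth)
  also have "\<dots> \<le> card (t_chains ?r t)"
    using chain \<open>finite (Field ?r)\<close> \<open>t \<ge> 1\<close>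
    by (intro sum_binomial_le_card_t_chains disjoint_family_on_tooth) auto
  also have "\<dots> \<le> RT_sharp n (antichain_poset k) l t"
    unfolding RT_sharp_antichain_poset[OF assms(1,2)]
    using Q \<open>width ?r \<le> card {1..L}\<close> L
    by (intro Max_ge finite_imageI imageI) (auto simp: finite_boolean_lattice)
  finally show ?thesis .
qed

section \<open>Asymptotics\<close>

lemma bigtheta_power_of_binomial_bounds:
  fixes f :: "nat \<Rightarrow> nat"
  assumes "L \<ge> 1" "t \<ge> 1"
    and upper: "\<And>n. f n \<le> (L * (n + 1)) choose t"
    and lower: "\<And>n. L \<le> n \<Longrightarrow> L * ((n - L + 1) choose t) \<le> f n"
  shows "(\<lambda>n. real (f n)) \<in> \<Theta>(\<lambda>n. real n ^ t)"
proof (rule bigthetaI')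
  show "0 < (1 / (2 * real t)) ^ t" "0 < (2 * real L) ^ t" using assms by simp_all
  \<comment> \<open>From \<open>2 * L + t\<close> on, \<open>n - L + 1\<close> is at least both \<open>n / 2\<close> and \<open>t\<close>.\<close>
  show "\<forall>\<^sub>F n in at_top. (1 / (2 * real t)) ^ t * norm (real n ^ t) \<le> norm (real (f n)) \<and>
      norm (real (f n)) \<le> (2 * real L) ^ t * norm (real n ^ t)"
    using eventually_ge_at_top[of "2 * L + t"]
  proof eventually_elim
    case (elim n)
    have "t \<le> 1 * (n + 1)" using elim by simp
    also have "\<dots> \<le> L * (n + 1)" using assms(1) by (intro mult_right_mono) auto
    finally have "t \<le> L * (n + 1)" .
    have "real (f n) \<le> real ((L * (n + 1)) ^ t)"
      using upper[of n] binomial_le_pow[OF \<open>t \<le> L * (n + 1)\<close>]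
      by (intro of_nat_mono) simp
    also have "\<dots> = (real L * real (n + 1)) ^ t" by (simp only: of_nat_power of_nat_mult)
    also have "\<dots> \<le> (real L * (2 * real n)) ^ t"
      using elim assms by (intro power_mono mult_left_mono) auto
    finally have up: "real (f n) \<le> (2 * real L) ^ t * real n ^ t"
      by (simp add: power_mult_distrib mult_ac)
    have "(1 / (2 * real t)) ^ t * real n ^ t = ((real n / 2) / real t) ^ t"
      by (simp add: power_mult_distrib power_divide)
    also have "\<dots> \<le> (real (n - L + 1) / real t) ^ t"
      using elim by (intro power_mono divide_right_mono) (auto simp: of_nat_diff)
    also have "\<dots> \<le> real ((n - L + 1) choose t)"
      using elim by (intro binomial_ge_n_over_k_pow_k) auto
    also have "\<dots> \<le> real (L * ((n - L + 1) choose t))"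
      using assms(1) by (intro of_nat_mono) simp
    also have "\<dots> \<le> real (f n)" using lower[of n] elim by (intro of_nat_mono) simp
    finally show ?case using up by simp
  qed
qed

theorem corollary4p1:
  fixes k l t L :: nat
  assumes "k \<ge> 1" and "l \<ge> 1" and "t \<ge> 1"
    and "L = min (l - 1) (k - 1)"
  shows
    "(\<forall>n\<ge>1. RT_sharp n (antichain_poset k) l t \<le>
        (if L = 0 then 0
         else (\<Sum>i=1..min t L. (L choose i) * ((i * (n + 1)) choose t)))) \<and>
     (\<forall>n\<ge>1. n \<ge> L \<longrightarrow>
        RT_sharp n (antichain_poset k) l t \<ge>
        (if L = 0 \<or> t > n - L + 1 then 0
         else L * ((n - L + 1) choose t))) \<and>
     (L \<ge> 1 \<longrightarrow>
        (\<lambda>n. real (RT_sharp n (antichain_poset k) l t)) \<in> \<Theta>(\<lambda>n. real n ^ t) \<and>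
        (t = 1 \<longrightarrow>
          (\<lambda>n. real (RT_sharp n (antichain_poset k) l 1) - real L * real n) \<in> O(\<lambda>_. 1)))"
proof -
  let ?RT = "\<lambda>n. RT_sharp n (antichain_poset k) l t"
  have upper: "?RT n \<le> (L * (n + 1)) choose t" for n
    using RT_sharp_antichain_poset_le[OF assms(1,2)] assms(4) by simp
  have lower: "L * ((n - L + 1) choose t) \<le> ?RT n" if "L \<le> n" for n
    using RT_sharp_antichain_poset_ge[OF assms that] .
  have "?RT n \<le> (if L = 0 then 0
      else (\<Sum>i=1..min t L. (L choose i) * ((i * (n + 1)) choose t)))" for n
    using upper[of n] binomial_mult_le_sum[OF assms(3), of L "n + 1"] assms(3)
    by (auto simp: binomial_eq_0)
  moreover have "?RT n \<ge> (if L = 0 \<or> t > n - L + 1 then 0 else L * ((n - L + 1) choose t))"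
    if "L \<le> n" for n
    using lower[OF that] by simp
  moreover have "(\<lambda>n. real (?RT n)) \<in> \<Theta>(\<lambda>n. real n ^ t)" if "L \<ge> 1"
    using bigtheta_power_of_binomial_bounds[OF that assms(3) upper lower] .
  moreover have "(\<lambda>n. real (RT_sharp n (antichain_poset k) l 1) - real L * real n) \<in> O(\<lambda>_. 1)"
    if "t = 1"
  proof (rule bigoI)
    show "\<forall>\<^sub>F n in at_top. norm (real (RT_sharp n (antichain_poset k) l 1) - real L * real n)
        \<le> (real L * real L + real L) * norm (1 :: real)"
      using eventually_ge_at_top[of L]
    proof eventually_elim
      case (elim n)
      have "real (?RT n) \<le> real (L * (n + 1))"
        using upper[of n] that by (intro of_nat_mono) simp
      moreover have "real (L * (n - L + 1)) \<le> real (?RT n)"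
        using lower[OF elim] that by (intro of_nat_mono) simp
      then have "real L * (real n - real L + 1) \<le> real (?RT n)"
        using elim by (simp only: of_nat_mult of_nat_add of_nat_diff of_nat_1)
      ultimately show ?case
        using that zero_le_square[of "real L"] by (simp add: algebra_simps abs_le_iff)
    qed
  qed
  ultimately show ?thesis by blast
qed

end
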